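(* Let $\mathbb{F}_q$ be a finite field with $q$ elements, let $P(X,Z)\in\mathbb{F}_q[X,Z]$ and $Q(X,Y,Z)\in\mathbb{F}_q[X,Y,Z]$. Suppose that $P(0,Z)\in\mathbb{F}_q[Z]$ has degree $m$ and that $Q(0,Y,Z)\in\mathbb{F}_q[Y,Z]$ is monic of degree $n$ in $Y$. Let $$N_0'=\#\{(\beta,\gamma)\in\mathbb{F}_q^2\mid P(0,\gamma)=0,\ Q(0,\beta,\gamma)=0\}.$$ Then $N_0'\le mn$.
   Context: "Monic of degree $n$ in $Y$" means that, as a polynomial in $Y$ over $\mathbb{F}_q[Z]$, it has degree $n$ and leading coefficient $1$. $P(0,Z)$ having degree $m$ means in particular that it is nonzero. *)

theory Defs
  imports "HOL-Computational_Algebra.Polynomial"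
begin

text \<open>
  Polynomial rings in several variables are iterated univariate ones:
  the ring \<open>F[X,Z]\<close> is \<open>(F[Z])[X]\<close>, i.e. \<open>'a poly poly\<close> with \<open>X\<close> outermost, and
  \<open>F[X,Y,Z]\<close> is \<open>((F[Z])[Y])[X]\<close>, i.e. \<open>'a poly poly poly\<close> with \<open>X\<close> outermost and \<open>Z\<close> innermost.
  Hence \<open>poly P 0\<close> is \<open>P(0,Z)\<close> in \<open>F[Z]\<close>, and \<open>poly Q 0\<close> is \<open>Q(0,Y,Z)\<close>, seen as a polynomial
  in \<open>Y\<close> over \<open>F[Z]\<close>.
\<close>

definition eval_XZ :: "'a::comm_ring_1 poly poly \<Rightarrow> 'a \<Rightarrow> 'a \<Rightarrow> 'a" where
  "eval_XZ P x z = poly (poly P [:x:]) z"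

definition eval_XYZ :: "'a::comm_ring_1 poly poly poly \<Rightarrow> 'a \<Rightarrow> 'a \<Rightarrow> 'a \<Rightarrow> 'a" where
  "eval_XYZ Q x y z = poly (poly (poly Q [:[:x:]:]) [:y:]) z"

end

theory Submission imports Defs
begin

text \<open>Count the pairs fibrewise over \<gamma>. The nonzero polynomial P(0,Z) has at most m
  roots \<gamma>. For each of them Q(0,Y,\<gamma>) is still monic of degree n in Y, because
  specializing Z cannot kill the leading coefficient 1, so at most n values \<beta> lie over
  \<gamma> (\<open>card_roots_specialization_le\<close>).\<close>

text \<open>Z may be specialized before Y, which turns the condition on y into a root condition for
  one univariate polynomial over the base ring.\<close>

lemma poly_poly_const_eq_poly_map_poly:
  fixes R :: "'a::comm_ring_1 poly poly"
  shows "poly (poly R [:y:]) z = poly (map_poly (\<lambda>c. poly c z) R) y"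
  by (induction R) (simp_all add: map_poly_pCons)

lemma card_roots_specialization_le:
  fixes R :: "'a::field poly poly"
  assumes "lead_coeff R = 1"
  shows "card {y. poly (poly R [:y:]) z = 0} \<le> degree R"
proof -
  let ?S = "map_poly (\<lambda>c. poly c z) R"
  \<comment> \<open>The leading coefficient is the constant polynomial 1, whose value at every z is
    1.\<close>
  have "coeff ?S (degree R) = 1"
    using assms by (simp add: coeff_map_poly)
  then have "?S \<noteq> 0"
    by auto
  then show "card {y. poly (poly R [:y:]) z = 0} \<le> degree R"
    using card_poly_roots_bound[of ?S]
      map_poly_degree_leq[of "\<lambda>c. poly c z" R]
    by (simp add: poly_poly_const_eq_poly_map_poly)
qed

theorem proposition5p1:
  fixes P :: "'a::{field, finite} poly poly"
    and Q :: "'a poly poly poly"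
    and q m n :: nat
  assumes "card (UNIV :: 'a set) = q"
    and "poly P 0 \<noteq> 0" and "degree (poly P 0) = m"
    and "degree (poly Q 0) = n" and "lead_coeff (poly Q 0) = 1"
  shows "card {(\<beta>, \<gamma>). eval_XZ P 0 \<gamma> = 0 \<and> eval_XYZ Q 0 \<beta> \<gamma> = 0} \<le> m * n"
proof -
  define A where "A = {\<gamma>. poly (poly P 0) \<gamma> = 0}"
  define B where "B \<gamma> = {\<beta>. poly (poly (poly Q 0) [:\<beta>:]) \<gamma> = 0}" for \<gamma>
  \<comment> \<open>The fibre \<open>B \<gamma>\<close> depends on the second component, so the
    pairs are swapped to form a dependent sum over \<open>A\<close>.\<close>
  have "{(\<beta>, \<gamma>). eval_XZ P 0 \<gamma> = 0 \<and> eval_XYZ Q 0 \<beta> \<gamma> = 0} = prod.swap ` Sigma A B"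
    by (auto simp: A_def B_def eval_XZ_def eval_XYZ_def image_iff)
  then have "card {(\<beta>, \<gamma>). eval_XZ P 0 \<gamma> = 0 \<and> eval_XYZ Q 0 \<beta> \<gamma> = 0} = card (Sigma A B)"
    by (simp add: card_image)
  also have "\<dots> = (\<Sum>\<gamma>\<in>A. card (B \<gamma>))"
    by (rule card_SigmaI) simp_all
  also have "\<dots> \<le> (\<Sum>\<gamma>\<in>A. n)"
    using card_roots_specialization_le[OF assms(5)] assms(4)
    by (intro sum_mono) (simp add: B_def)
  also have "\<dots> = card A * n"
    by simp
  also have "\<dots> \<le> m * n"
    using card_poly_roots_bound[OF assms(2)] assms(3) by (simp add: A_def)
  finally show ?thesis .
qed

end
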